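(* Let $g \geq 2$ be an integer and let $f\colon \mathbb{N}\to\mathbb{N}$ be a positive-integer-valued arithmetic function. Suppose that $f$ is of weakly polynomial growth, i.e. there are constants $c>0$, $C>0$ and $x_1$ (depending on $f$) such that \[ \sum_{m \leq x} \log f(m) \geq c\, x\log x \quad \text{for all } x > x_1, \qquad\text{and}\qquad \log f(m) \leq C \log m \quad\text{for all } m\in\mathbb{N}. \] Suppose moreover that for every meager set $\mathcal{E}\subset\mathbb{N}$, the inverse image $f^{-1}(\mathcal{E})=\{n\in\mathbb{N}: f(n)\in\mathcal{E}\}$ has asymptotic density zero. Then the real number \[ \alpha_f := 0.f(1) f(2) f(3) \ldots, \] obtained by concatenating the base-$g$ digits of $f(1), f(2), f(3), \dots$ in succession, is $g$-normal.
   Context: Throughout, $\ln x$ is the natural logarithm and $\log x := \max\{1, \ln x\}$. A set $\mathcal{E}\subset\mathbb{N}$ is called meager if there exist $\delta<1$ and $x_0>0$ such that $\#(\mathcal{E}\cap[1,x]) < x^{\delta}$ for all $x > x_0$. The asymptotic density of $\mathcal{S}\subset\mathbb{N}$ is $\lim_{x\to\infty}\#(\mathcal{S}\cap[1,x])/x$ when it exists. A real number is $g$-normal if, for every $k\ge1$, every word of length $k$ on the alphabet $\{0,1,\dots,g-1\}$ occurs in its base-$g$ expansion with limiting frequency $g^{-k}$. *)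

theory Defs
  imports "HOL-Analysis.Analysis" "HOL-Library.Stream"
begin

text \<open>
  The set of natural numbers meant here is that of the positive integers.  An arithmetic function
  is an \<^typ>\<open>nat \<Rightarrow> nat\<close> of which only the values at arguments \<open>n \<ge> 1\<close> are ever used.
\<close>

definition log1 :: "real \<Rightarrow> real" where
  "log1 x = max 1 (ln x)"

definition counting :: "nat set \<Rightarrow> real \<Rightarrow> nat" where
  "counting S x = card {n \<in> S. 1 \<le> n \<and> real n \<le> x}"

definition meager :: "nat set \<Rightarrow> bool" where
  "meager E \<longleftrightarrow> E \<subseteq> {1..} \<and>
     (\<exists>\<delta> x\<^sub>0::real. \<delta> < 1 \<and> x\<^sub>0 > 0 \<and> (\<forall>x>x\<^sub>0. real (counting E x) < x powr \<delta>))"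

definition has_asymptotic_density :: "nat set \<Rightarrow> real \<Rightarrow> bool" where
  "has_asymptotic_density S d \<longleftrightarrow> ((\<lambda>x::real. real (counting S x) / x) \<longlongrightarrow> d) at_top"

definition weakly_polynomial_growth :: "(nat \<Rightarrow> nat) \<Rightarrow> bool" where
  "weakly_polynomial_growth f \<longleftrightarrow>
     (\<exists>c C x\<^sub>1::real. c > 0 \<and> C > 0 \<and>
        (\<forall>x>x\<^sub>1. (\<Sum>m | 1 \<le> m \<and> real m \<le> x. log1 (real (f m))) \<ge> c * x * log1 x) \<and>
        (\<forall>m\<ge>1. log1 (real (f m)) \<le> C * log1 (real m)))"

text \<open>
  Digits of \<open>n\<close> in base \<open>g\<close>, most significant digit first and without leading zeros.
  The guard \<open>g < 2\<close> only serves termination.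
\<close>

fun base_digits :: "nat \<Rightarrow> nat \<Rightarrow> nat list" where
  "base_digits g n = (if n = 0 \<or> g < 2 then [] else base_digits g (n div g) @ [n mod g])"

declare base_digits.simps [simp del]

text \<open>
  The blocks \<open>f 1, f 2, \<dots>\<close> joined into one infinite digit sequence.  The function \<^const>\<open>flat\<close>
  is concatenation for streams of nonempty lists, hence this requires \<open>g \<ge> 2\<close> and \<open>f n \<ge> 1\<close> for
  all \<open>n \<ge> 1\<close>.
\<close>

definition concat_digits :: "nat \<Rightarrow> (nat \<Rightarrow> nat) \<Rightarrow> nat stream" where
  "concat_digits g f = flat (smap (\<lambda>n. base_digits g (f n)) (fromN 1))"

definition concat_real :: "nat \<Rightarrow> (nat \<Rightarrow> nat) \<Rightarrow> real" where
  "concat_real g f = (\<Sum>i. real (concat_digits g f !! i) / real g ^ (i + 1))"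

text \<open>
  The digit of \<open>\<bar>x\<bar>\<close> with place value \<open>1 / g ^ (i + 1)\<close>.  For a number with two expansions, this is the one
  that ends in zeros.
\<close>

definition expansion_digit :: "nat \<Rightarrow> real \<Rightarrow> nat \<Rightarrow> nat" where
  "expansion_digit g x i = nat (\<lfloor>\<bar>x\<bar> * real g ^ (i + 1)\<rfloor> mod int g)"

text \<open>
  An occurrence of \<open>w\<close> is counted according to the position at which it starts, so overlapping
  occurrences are counted separately.
\<close>

definition normal_in_base :: "nat \<Rightarrow> real \<Rightarrow> bool" where
  "normal_in_base g x \<longleftrightarrow>
     (\<forall>k\<ge>1. \<forall>w. length w = k \<and> set w \<subseteq> {0..<g} \<longrightarrow>
        (\<lambda>N. real (card {i. i < N \<and> map (expansion_digit g x) [i..<i + k] = w}) / real N)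
          \<longlonglongrightarrow> 1 / real g ^ k)"

end

theory Submission
  imports Defs
begin

text \<open>
  The starting positions of occurrences of a word \<open>w\<close> of length \<open>k\<close> in the digits of \<open>n\<close> split into
  residue classes modulo \<open>k\<close>. In each class one counts a single digit in base \<open>g ^ k\<close>, where the
  digits are independent, and Chernoff's bound shows that the \<open>n\<close> with too few occurrences form a
  meager set. Hence all but \<open>o(X)\<close> of the blocks \<open>f 1, \<dots>, f X\<close> contain \<open>w\<close> about as often as
  expected. The exceptional blocks and the incomplete last one have \<open>o(X log X)\<close> digits, and the
  loss at block boundaries is \<open>O(X)\<close>; both are negligible against a total of order \<open>X log X\<close>. This
  bounds the lower frequency of every word, which is enough since the frequencies add up to 1.
\<close>

section \<open>Chernoff's bound for digit counts\<close>

text \<open>At \<open>t = 0\<close> the left side equals \<open>b\<close> and has derivative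
  \<open>- b * e < 0\<close>, so every small positive \<open>t\<close> works. Divided by
  \<open>b\<close>, the left side becomes the decay factor per digit in Chernoff's bound for a digit
  frequency below \<open>1 / b - e\<close>.\<close>

lemma chernoff_parameter:
  fixes b e :: real
  assumes "b > 1" "e > 0"
  shows "\<exists>t>0. (b - 1 + exp (-t)) * exp (t * (1 / b - e)) < b"
proof -
  let ?h = "\<lambda>t::real. (b - 1 + exp (-t)) * exp (t * (1 / b - e))"
  have "(?h has_real_derivative (- exp (-0) * exp (0 * (1/b - e)) + (b - 1 + exp (-0)) * (exp (0 * (1/b - e)) * (1/b - e)))) (at 0)"
    by (rule derivative_eq_intros refl | simp)+
  then have d: "(?h has_real_derivative (- b * e)) (at 0)"
    using assms by (simp add: field_simps)
  have "- b * e < 0"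
    using assms by simp
  then obtain t0 where "t0 > 0" and t0: "\<And>t. 0 < t \<Longrightarrow> t < t0 \<Longrightarrow> ?h (0 + t) < ?h 0"
    using DERIV_neg_dec_right[OF d] by blast
  have "?h (t0 / 2) < b"
    using t0[of "t0 / 2"] \<open>t0 > 0\<close> by simp
  then show ?thesis
    using \<open>t0 > 0\<close> by (intro exI[of _ "t0 / 2"]) simp
qed

text \<open>Exactly the \<open>J\<close> lowest digits are inspected, leading zeros included. Over a
  range of length \<open>T * b ^ J\<close> starting at 0 they are therefore uniform and
  independent.\<close>

definition digit_count :: "nat \<Rightarrow> nat \<Rightarrow> nat \<Rightarrow> nat \<Rightarrow> nat" where
  "digit_count b v J n = card {q. q < J \<and> n div b ^ q mod b = v}"

lemma digit_count_0 [simp]: "digit_count b v 0 n = 0"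
  by (simp add: digit_count_def)

lemma digit_count_Suc:
  assumes "d < b"
  shows "digit_count b v (Suc J) (m * b + d) = of_bool (d = v) + digit_count b v J m"
proof -
  have eq: "{q. q < Suc J \<and> (m * b + d) div b ^ q mod b = v} =
      (if d = v then {0} else {}) \<union> Suc ` {q. q < J \<and> m div b ^ q mod b = v}" (is "?A = ?B")
  proof (intro equalityI subsetI)
    fix q assume "q \<in> ?A"
    then show "q \<in> ?B"
      using assms by (cases q) (auto simp: div_mult2_eq split: if_splits)
  next
    fix q assume "q \<in> ?B"
    then show "q \<in> ?A"
      using assms by (auto simp: div_mult2_eq split: if_splits)
  qed
  show ?thesis
    unfolding digit_count_def eq
    by (subst card_Un_disjoint) (auto simp: card_image)
qed

lemma sum_lessThan_mult:
  fixes F :: "nat \<Rightarrow> 'a :: comm_monoid_add"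
  shows "(\<Sum>n<X * b. F n) = (\<Sum>m<X. \<Sum>d<b. F (m * b + d))"
proof -
  have "sum F {m * b..<m * b + b} = (\<Sum>d<b. F (m * b + d))" for m
    using sum.shift_bounds_nat_ivl[of F 0 "m * b" b] by (simp add: add.commute atLeast0LessThan)
  then show ?thesis
    by (simp flip: sum.nat_group)
qed

text \<open>This is the moment generating function of the digit count. Peeling off the lowest digit
  multiplies the sum by \<open>b - 1 + z\<close>, since one of its \<open>b\<close> values
  contributes \<open>z\<close> and each other value 1. The factor \<open>T\<close> stands for the
  part above the inspected digits, which is free.\<close>

lemma sum_power_digit_count:
  fixes z :: real
  assumes "v < b"
  shows "(\<Sum>n<T * b ^ J. z ^ digit_count b v J n) = real T * (real b - 1 + z) ^ J"
proof (induction J)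
  case (Suc J)
  have "(\<Sum>n<T * b ^ Suc J. z ^ digit_count b v (Suc J) n) =
      (\<Sum>m<T * b ^ J. \<Sum>d<b. z ^ digit_count b v (Suc J) (m * b + d))"
    using sum_lessThan_mult[of _ "T * b ^ J" b] by (simp add: algebra_simps)
  also have "\<dots> = (\<Sum>m<T * b ^ J. \<Sum>d<b. z ^ of_bool (d = v) * z ^ digit_count b v J m)"
    by (intro sum.cong refl) (simp add: digit_count_Suc power_add)
  also have "\<dots> = (\<Sum>d<b. z ^ of_bool (d = v)) * (\<Sum>m<T * b ^ J. z ^ digit_count b v J m)"
    by (subst sum.swap) (simp add: sum_product)
  also have "(\<Sum>d<b. z ^ of_bool (d = v)) = real b - 1 + z"
  proof -
    have "(\<Sum>d<b. z ^ of_bool (d = v)) = z + (\<Sum>d\<in>{..<b} - {v}. z ^ of_bool (d = v))"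
      using assms by (subst sum.remove[of _ v]) auto
    also have "(\<Sum>d\<in>{..<b} - {v}. z ^ of_bool (d = v)) = (\<Sum>d\<in>{..<b} - {v}. 1)"
      by (intro sum.cong) auto
    finally show ?thesis
      using assms by (simp add: of_nat_diff)
  qed
  finally show ?case
    by (simp add: Suc.IH)
qed simp

text \<open>Markov's inequality in exponential form: each counted \<open>n\<close> contributes at
  least 1 to the sum of \<open>exp (t * (p * J - count))\<close>, which the generating function
  evaluates. The factor \<open>a\<close> stands for the low part removed by \<open>n div a\<close>,
  and \<open>T\<close> for the part above the inspected digits.\<close>

lemma card_few_digits_le:
  assumes "v < b" "t > 0"
  shows "real (card {n. n < a * T * b ^ J \<and> real (digit_count b v J (n div a)) < p * real J})
    \<le> real (a * T) * ((real b - 1 + exp (-t)) * exp (t * p)) ^ J"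
proof (cases "a = 0")
  case False
  let ?c = "\<lambda>n. digit_count b v J (n div a)"
  let ?S = "{n. n < a * T * b ^ J \<and> real (?c n) < p * real J}"
  have "real (card ?S) = (\<Sum>n\<in>?S. 1)"
    by simp
  also have "\<dots> \<le> (\<Sum>n\<in>?S. exp (-t) ^ ?c n * exp (t * p) ^ J)"
  proof (intro sum_mono)
    fix n assume n: "n \<in> ?S"
    have "exp (-t) ^ ?c n * exp (t * p) ^ J = exp (t * (p * real J - real (?c n)))"
      by (simp add: exp_of_nat_mult[symmetric] exp_add[symmetric] algebra_simps)
    then show "1 \<le> exp (-t) ^ ?c n * exp (t * p) ^ J"
      using n assms by simp
  qed
  also have "\<dots> \<le> (\<Sum>n<T * b ^ J * a. exp (-t) ^ ?c n * exp (t * p) ^ J)"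
    by (intro sum_mono2) (auto simp: algebra_simps)
  also have "\<dots> = (\<Sum>m<T * b ^ J. \<Sum>d<a. exp (-t) ^ ?c (m * a + d) * exp (t * p) ^ J)"
    by (rule sum_lessThan_mult)
  also have "\<dots> = (\<Sum>m<T * b ^ J. \<Sum>d<a. exp (-t) ^ digit_count b v J m * exp (t * p) ^ J)"
    by (intro sum.cong refl) simp
  also have "\<dots> = real a * exp (t * p) ^ J * (\<Sum>m<T * b ^ J. exp (-t) ^ digit_count b v J m)"
    by (simp add: sum_distrib_left algebra_simps)
  also have "\<dots> = real (a * T) * ((real b - 1 + exp (-t)) * exp (t * p)) ^ J"
    using assms by (simp add: sum_power_digit_count power_mult_distrib)
  finally show ?thesis .
qed simp

section \<open>Digits, residues and words\<close>

lemma base_digits_0 [simp]: "base_digits g 0 = []"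
  by (simp add: base_digits.simps)

lemma base_digits_pos:
  assumes "g \<ge> 2" "n > 0"
  shows "base_digits g n = base_digits g (n div g) @ [n mod g]"
  using assms by (subst base_digits.simps) simp

lemma base_digits_eq_Nil_iff:
  assumes "g \<ge> 2"
  shows "base_digits g n = [] \<longleftrightarrow> n = 0"
  using assms base_digits_pos by (cases "n = 0") auto

lemma set_base_digits: "g \<ge> 2 \<Longrightarrow> set (base_digits g n) \<subseteq> {0..<g}"
proof (induction n rule: less_induct)
  case (less n)
  show ?case
  proof (cases "n = 0")
    case False
    then have "n div g < n"
      using less.prems by simp
    then show ?thesis
      using less False by (auto simp: base_digits_pos)
  qed simp
qed

lemma less_power_length_base_digits: "g \<ge> 2 \<Longrightarrow> n < g ^ length (base_digits g n)"
proof (induction n rule: less_induct)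
  case (less n)
  show ?case
  proof (cases "n = 0")
    case False
    then have "n div g < g ^ length (base_digits g (n div g))"
      using less by simp
    then have "n < g ^ length (base_digits g (n div g)) * g"
      using less.prems by (simp add: div_less_iff_less_mult)
    then show ?thesis
      using less.prems False by (simp add: base_digits_pos algebra_simps)
  qed simp
qed

lemma power_length_base_digits_le: "g \<ge> 2 \<Longrightarrow> n > 0 \<Longrightarrow> g ^ length (base_digits g n) \<le> g * n"
proof (induction n rule: less_induct)
  case (less n)
  show ?case
  proof (cases "n div g = 0")
    case True
    then show ?thesis
      using less by (simp add: base_digits_pos)
  next
    case False
    then have "g ^ length (base_digits g (n div g)) \<le> g * (n div g)"
      using less by simp
    also have "\<dots> \<le> n"
      by simp
    finally show ?thesis
      using less.prems False by (simp add: base_digits_pos)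
  qed
qed

lemma base_digits_div_power:
  assumes "g \<ge> 2"
  shows "base_digits g (n div g ^ j) = take (length (base_digits g n) - j) (base_digits g n)"
proof (induction j)
  case (Suc j)
  let ?m = "n div g ^ j"
  have "base_digits g (?m div g) = butlast (base_digits g ?m)"
    using assms by (cases "?m = 0") (simp_all add: base_digits_pos)
  also have "\<dots> = take (length (base_digits g n) - Suc j) (base_digits g n)"
    by (simp add: Suc.IH butlast_take)
  finally show ?case
    by (simp add: div_mult2_eq[symmetric] mult.commute)
qed simp

definition word_value :: "nat \<Rightarrow> nat list \<Rightarrow> nat" where
  "word_value g w = foldl (\<lambda>a d. a * g + d) 0 w"

lemma word_value_snoc [simp]: "word_value g (w @ [d]) = word_value g w * g + d"
  by (simp add: word_value_def)

lemma word_value_less: "set w \<subseteq> {0..<g} \<Longrightarrow> word_value g w < g ^ length w"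
proof (induction w rule: rev_induct)
  case (snoc d w)
  then have "word_value g w + 1 \<le> g ^ length w" "d < g"
    by auto
  then have "(word_value g w + 1) * g \<le> g ^ length w * g"
    by (intro mult_right_mono) auto
  then show ?case
    using \<open>d < g\<close> by (simp add: algebra_simps)
qed (simp add: word_value_def)

text \<open>A residue modulo \<open>g ^ length w\<close> determines the last digits only up to
  padding by zeros. The assumption on lengths ensures that leading zeros of \<open>w\<close> are
  digits really written in \<open>m\<close>.\<close>

lemma base_digits_suffix:
  assumes "g \<ge> 2" "set w \<subseteq> {0..<g}"
    and "length w \<le> length (base_digits g m)" "m mod g ^ length w = word_value g w"
  shows "\<exists>ys. base_digits g m = ys @ w"
  using assms(2-)
proof (induction w arbitrary: m rule: rev_induct)
  case (snoc d w)
  have m: "m > 0"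
    using snoc.prems(2) by (cases "m = 0") auto
  have d: "d < g"
    using snoc.prems by simp
  have v: "m mod (g * g ^ length w) = word_value g w * g + d"
    using snoc.prems by simp
  have "m mod g = (m mod (g * g ^ length w)) mod g"
    by (simp add: mod_mult2_eq)
  then have md: "m mod g = d"
    using d v by simp
  have "(m div g) mod g ^ length w = (m mod (g * g ^ length w)) div g"
    using assms(1) by (simp add: mod_mult2_eq)
  then have "(m div g) mod g ^ length w = word_value g w"
    using d v by simp
  then obtain ys where "base_digits g (m div g) = ys @ w"
    using snoc.IH[of "m div g"] snoc.prems base_digits_pos[OF assms(1) m] by auto
  then show ?case
    using md base_digits_pos[OF assms(1) m] by simp
qed simp

section \<open>Occurrences of a word inside one number\<close>

definition occurrences :: "'a list \<Rightarrow> 'a list \<Rightarrow> nat" where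
  "occurrences w xs = card {i. i + length w \<le> length xs \<and> take (length w) (drop i xs) = w}"

lemma finite_occurrences: "finite {i. i + length w \<le> length xs \<and> P i}"
  by (rule finite_subset[of _ "{..length xs}"]) auto

lemma occurrences_base_digits_ge:
  fixes g n :: nat
  assumes g: "g \<ge> 2" and w: "set w \<subseteq> {0..<g}" "w \<noteq> []"
  defines "k \<equiv> length w" and "l \<equiv> length (base_digits g n)"
  shows "(\<Sum>r<k. digit_count (g ^ k) (word_value g w) ((l - r) div k) (n div g ^ r))
    \<le> occurrences w (base_digits g n)"
proof -
  have k: "k > 0"
    using w by (simp add: k_def)
  define A where "A r = {q. q < (l - r) div k \<and> n div g ^ r div (g ^ k) ^ q mod g ^ k = word_value g w}" for r
  define O' where "O' = {i. i + length w \<le> length (base_digits g n) \<and> take (length w) (drop i (base_digits g n)) = w}"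
  \<comment> \<open>Converts the number of digits after the copy, counted from the right, into its
    starting index from the left.\<close>
  define h where "h = (\<lambda>(r, q). l - k - (r + k * q))"
  have le: "r + k * q + k \<le> l" if "q \<in> A r" for r q
  proof -
    have "Suc q \<le> (l - r) div k"
      using that by (simp add: A_def)
    then have "Suc q * k \<le> l - r"
      using k by (simp add: less_eq_div_iff_mult_less_eq)
    then show ?thesis
      using k by (cases "r \<le> l") (auto simp: algebra_simps)
  qed
  have finA: "finite (A r)" for r
    by (simp add: A_def)
  have "inj_on h (SIGMA r:{..<k}. A r)"
  proof (rule inj_onI)
    fix x y assume xy: "x \<in> (SIGMA r:{..<k}. A r)" "y \<in> (SIGMA r:{..<k}. A r)" "h x = h y"
    obtain r q r' q' where [simp]: "x = (r, q)" "y = (r', q')"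
      by (cases x, cases y)
    have *: "r < k" "q \<in> A r" "r' < k" "q' \<in> A r'" "l - k - (r + k * q) = l - k - (r' + k * q')"
      using xy by (simp_all add: h_def)
    \<comment> \<open>By \<open>le\<close> the subtractions in \<open>h\<close> are not cut off at
      0, so they can be cancelled.\<close>
    have eq: "r + k * q = r' + k * q'"
      using le[OF *(2)] le[OF *(4)] *(5) by linarith
    have "r = (r + k * q) mod k" "r' = (r' + k * q') mod k"
      using * by auto
    then have "r = r'"
      using eq by simp
    then show "x = y"
      using eq k by simp
  qed
  moreover have "h ` (SIGMA r:{..<k}. A r) \<subseteq> O'"
  proof (rule image_subsetI)
    fix x assume x: "x \<in> (SIGMA r:{..<k}. A r)"
    then obtain r q where [simp]: "x = (r, q)" and q: "q \<in> A r"
      by auto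
    define j where "j = r + k * q"
    have j: "j + k \<le> l"
      using le[OF q] by (simp add: j_def)
    have "n div g ^ r div (g ^ k) ^ q = n div g ^ j"
      by (simp add: j_def div_mult2_eq[symmetric] power_add power_mult)
    then have "(n div g ^ j) mod g ^ length w = word_value g w"
      using q by (simp add: A_def k_def)
    moreover have tk: "base_digits g (n div g ^ j) = take (l - j) (base_digits g n)"
      using g by (simp add: base_digits_div_power l_def)
    moreover have "length w \<le> length (take (l - j) (base_digits g n))"
      using j by (simp add: l_def k_def)
    ultimately obtain ys where ys: "take (l - j) (base_digits g n) = ys @ w"
      using base_digits_suffix[OF g w(1), of "n div g ^ j"] by auto
    have len: "length ys = l - k - j"
      using arg_cong[OF ys, of length] j by (simp add: l_def k_def)
    have "base_digits g n = ys @ w @ drop (l - j) (base_digits g n)"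
      using append_take_drop_id[of "l - j" "base_digits g n"] unfolding ys by simp
    then have "take k (drop (length ys) (base_digits g n)) = w"
      by (metis append_eq_conv_conj k_def)
    then show "h x \<in> O'"
      using j len by (simp add: h_def O'_def k_def[symmetric] l_def[symmetric] j_def[symmetric])
  qed
  moreover have "finite O'"
    unfolding O'_def by (rule finite_occurrences)
  ultimately have "card (SIGMA r:{..<k}. A r) \<le> card O'"
    by (rule card_inj_on_le)
  then show ?thesis
    using finA by (simp add: card_SigmaI occurrences_def O'_def digit_count_def A_def)
qed

section \<open>Numbers in which a word is scarce form a meager set\<close>

lemma sum_powers_le:
  fixes y :: real
  assumes "y > 1"
  shows "(\<Sum>l\<le>m. y ^ l) \<le> y / (y - 1) * y ^ m"
proof (induction m)
  case 0
  then show ?case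
    using assms by simp
next
  case (Suc m)
  have "y / (y - 1) * y ^ m + y ^ Suc m = y / (y - 1) * y ^ Suc m"
    using assms by (simp add: field_simps)
  then show ?case
    using Suc by simp
qed

text \<open>Numbers up to \<open>x\<close> have at most \<open>m\<close> digits with
  \<open>g ^ m \<le> g * x\<close>, so a geometric sum bounds the count by a constant times
  \<open>y ^ m\<close>. Since \<open>y = g powr d\<close> with \<open>d < 1\<close>, this is of
  order \<open>x powr d\<close>.\<close>

lemma meagerI:
  fixes y K :: real
  assumes g: "g \<ge> 2" and E: "E \<subseteq> {1..}" and y: "1 < y" "y < real g" and "K \<ge> 0"
    and bound: "\<And>l. real (card {n \<in> E. length (base_digits g n) = l}) \<le> K * y ^ l"
  shows "meager E"
proof -
  define d where "d = log (real g) y"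
  have d: "0 < d" "d < 1"
    using y g by (simp_all add: d_def)
  define C where "C = K * (y / (y - 1)) * y"
  have fin: "finite {n \<in> E. length (base_digits g n) = l}" for l
    by (rule finite_subset[of _ "{..<g ^ l}"]) (use less_power_length_base_digits[OF g] in auto)
  have count: "real (counting E x) \<le> C * x powr d" if x: "x \<ge> 1" for x
  proof -
    define N where "N = nat \<lfloor>x\<rfloor>"
    define m where "m = length (base_digits g N)"
    have N: "N \<ge> 1" "real N \<le> x"
      using x by (auto simp: N_def le_nat_floor)
    have "{n \<in> E. 1 \<le> n \<and> real n \<le> x} \<subseteq> (\<Union>l\<in>{..m}. {n \<in> E. length (base_digits g n) = l})"
    proof
      fix n assume n: "n \<in> {n \<in> E. 1 \<le> n \<and> real n \<le> x}"
      then have "n \<le> N"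
        by (auto simp: N_def le_nat_floor)
      have "g ^ length (base_digits g n) \<le> g * n"
        using power_length_base_digits_le[OF g, of n] n by simp
      also have "\<dots> \<le> g * N"
        using \<open>n \<le> N\<close> by simp
      also have "\<dots> < g ^ Suc m"
        using less_power_length_base_digits[OF g, of N] g by (simp add: m_def)
      finally have "length (base_digits g n) < Suc m"
        using g by (simp only: power_strict_increasing_iff)
      then show "n \<in> (\<Union>l\<in>{..m}. {n \<in> E. length (base_digits g n) = l})"
        using n by auto
    qed
    then have "counting E x \<le> card (\<Union>l\<in>{..m}. {n \<in> E. length (base_digits g n) = l})"
      unfolding counting_def by (intro card_mono) (use fin in auto)
    also have "\<dots> \<le> (\<Sum>l\<le>m. card {n \<in> E. length (base_digits g n) = l})"
      by (rule card_UN_le) simp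
    finally have "real (counting E x) \<le> (\<Sum>l\<le>m. real (card {n \<in> E. length (base_digits g n) = l}))"
      by (metis of_nat_le_iff of_nat_sum)
    also have "\<dots> \<le> (\<Sum>l\<le>m. K * y ^ l)"
      by (intro sum_mono bound)
    also have "\<dots> = K * (\<Sum>l\<le>m. y ^ l)"
      by (simp add: sum_distrib_left)
    also have "\<dots> \<le> K * (y / (y - 1) * y ^ m)"
      using \<open>K \<ge> 0\<close> y by (intro mult_left_mono sum_powers_le) auto
    also have "y ^ m \<le> y * x powr d"
    proof -
      have "y = real g powr d"
        using y g by (simp add: d_def)
      then have "y ^ m = (real g ^ m) powr d"
        using g by (simp add: powr_powr powr_realpow[symmetric] mult.commute del: powr_realpow)
      also have "\<dots> \<le> (real g * x) powr d"
      proof (intro powr_mono2)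
        have "real (g ^ m) \<le> real (g * N)"
          unfolding of_nat_le_iff m_def using power_length_base_digits_le[OF g, of N] N by simp
        also have "\<dots> \<le> real g * x"
          using N by (simp add: mult_left_mono)
        finally show "real g ^ m \<le> real g * x"
          by simp
      qed (use d in auto)
      also have "\<dots> = y * x powr d"
        using x \<open>y = _\<close> by (simp add: powr_mult)
      finally show ?thesis .
    qed
    finally show ?thesis
      using \<open>K \<ge> 0\<close> y by (simp add: C_def mult_left_mono mult_right_mono divide_right_mono algebra_simps)
  qed
  \<comment> \<open>An exponent strictly between \<open>d\<close> and 1 absorbs the constant:
    \<open>x powr (d' - d)\<close> is at least \<open>C + 1\<close>, hence above \<open>C\<close>,
    once \<open>x\<close> exceeds \<open>x0\<close>.\<close>
  define d' where "d' = (1 + d) / 2"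
  have d': "d < d'" "d' < 1"
    using d by (simp_all add: d'_def)
  define x0 where "x0 = max 1 ((C + 1) powr (1 / (d' - d)))"
  have "C \<ge> 0"
    using \<open>K \<ge> 0\<close> y by (simp add: C_def)
  have "real (counting E x) < x powr d'" if "x > x0" for x
  proof -
    have x: "x > 1" "x > (C + 1) powr (1 / (d' - d))"
      using that by (auto simp: x0_def)
    have "C < ((C + 1) powr (1 / (d' - d))) powr (d' - d)"
      using d' \<open>C \<ge> 0\<close> by (simp add: powr_powr)
    also have "\<dots> \<le> x powr (d' - d)"
      using x d' by (intro powr_mono2) auto
    finally have "C * x powr d < x powr (d' - d) * x powr d"
      using x by (intro mult_strict_right_mono) auto
    also have "\<dots> = x powr d'"
      by (simp add: powr_add[symmetric])
    finally show ?thesis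
      using count[of x] x by linarith
  qed
  moreover have "x0 > 0"
    by (simp add: x0_def)
  ultimately show ?thesis
    unfolding meager_def using E d' by blast
qed

text \<open>
  The exceptional set: along some residue class \<open>r\<close> modulo \<open>k = length w\<close> of starting positions,
  where occurrences of \<open>w\<close> are digits of \<open>n div g ^ r\<close> in base \<open>g ^ k\<close>, the word is too rare.
\<close>

definition scarce :: "nat \<Rightarrow> nat list \<Rightarrow> real \<Rightarrow> nat set" where
  "scarce g w p = {n. n \<ge> 1 \<and> (\<exists>r<length w.
     real (digit_count (g ^ length w) (word_value g w)
       ((length (base_digits g n) - r) div length w) (n div g ^ r))
     < p * real ((length (base_digits g n) - r) div length w))}"

text \<open>For each of the \<open>k\<close> residue classes, Chernoff's bound leaves a proportion
  \<open>\<theta> ^ J\<close> of the integers below \<open>g ^ l\<close>, where \<open>J\<close> is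
  about \<open>l / k\<close>. A union bound over the classes then gives exponential growth in
  \<open>l\<close> with a base below \<open>g\<close>, as \<open>meagerI\<close> asks.\<close>

lemma meager_scarce:
  assumes g: "g \<ge> 2" and w: "set w \<subseteq> {0..<g}" "w \<noteq> []" and e: "e > 0"
  shows "meager (scarce g w (1 / real g ^ length w - e))"
proof -
  define k where "k = length w"
  define b where "b = g ^ k"
  define v where "v = word_value g w"
  define p where "p = 1 / real b - e"
  have k: "k > 0"
    using w by (simp add: k_def)
  have vb: "v < b"
    using word_value_less[OF w(1)] by (simp add: v_def b_def k_def)
  have b1: "real b > 1"
    using g k by (simp add: b_def)
  obtain t where t: "t > 0" "(real b - 1 + exp (-t)) * exp (t * p) < real b"
    using chernoff_parameter[OF b1 e] by (auto simp: p_def)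
  define \<rho> where "\<rho> = (real b - 1 + exp (-t)) * exp (t * p)"
  define \<theta> where "\<theta> = \<rho> / real b"
  have \<theta>: "0 < \<theta>" "\<theta> < 1"
    using t b1 by (auto simp: \<theta>_def \<rho>_def intro!: divide_pos_pos mult_pos_pos add_pos_pos)
  \<comment> \<open>The \<open>k\<close>-th root turns decay per block of \<open>k\<close> digits
    into decay per digit. The maximum with \<open>3 / 4\<close> makes \<open>y = g * \<tau>\<close>
    exceed 1, because \<open>g \<ge> 2\<close>.\<close>
  define \<tau> where "\<tau> = max (root k \<theta>) (3 / 4)"
  have \<tau>: "3 / 4 \<le> \<tau>" "\<tau> < 1" 
    using \<theta> k by (auto simp: \<tau>_def)
  have "\<theta> = root k \<theta> ^ k"
    using \<theta> k by simp
  also have "\<dots> \<le> \<tau> ^ k"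
    using \<theta> k by (intro power_mono) (auto simp: \<tau>_def)
  finally have \<theta>\<tau>: "\<theta> \<le> \<tau> ^ k" .
  define y where "y = real g * \<tau>"
  define Bad where "Bad r l = {n. n < g ^ l \<and> real (digit_count b v ((l - r) div k) (n div g ^ r)) < p * real ((l - r) div k)}" for r l
  have bad: "real (card (Bad r l)) \<le> y ^ l / \<tau> ^ (2 * k)" if r: "r < k" for r l
  proof (cases "r \<le> l")
    case True
    define J where "J = (l - r) div k"
    have J: "r + k * J \<le> l"
      using True times_div_less_eq_dividend[of k "l - r"] unfolding J_def by linarith
    \<comment> \<open>Fewer than \<open>k\<close> digits are lost at the low end and fewer than
      \<open>k\<close> at the high end; this costs the factor
      \<open>1 / \<tau> ^ (2 * k)\<close>.\<close>
    have J2: "l < k * J + 2 * k"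
      using True r k dividend_less_div_times[of k "l - r"] unfolding J_def by (simp add: algebra_simps)
    define T where "T = g ^ (l - r - k * J)"
    have gl: "g ^ r * T * b ^ J = g ^ l"
      using J by (simp add: T_def b_def power_add[symmetric] power_mult[symmetric])
    have "real (card (Bad r l)) \<le> real (g ^ r * T) * \<rho> ^ J"
      using card_few_digits_le[OF vb t(1), of "g ^ r" T J p]
      unfolding gl by (simp add: Bad_def J_def \<rho>_def)
    also have "\<dots> = real (g ^ r * T * b ^ J) * \<theta> ^ J"
      using b1 by (simp add: \<theta>_def power_divide)
    also have "\<dots> = real g ^ l * \<theta> ^ J"
      unfolding gl by simp
    also have "\<theta> ^ J \<le> (\<tau> ^ k) ^ J"
      using \<theta> \<theta>\<tau> by (intro power_mono) auto
    also have "(\<tau> ^ k) ^ J \<le> \<tau> ^ l / \<tau> ^ (2 * k)"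
    proof -
      have "\<tau> ^ (k * J + 2 * k) \<le> \<tau> ^ l"
        using J2 \<tau> by (intro power_decreasing) auto
      then show ?thesis
        using \<tau> by (simp add: power_add power_mult[of \<tau> k J] pos_le_divide_eq)
    qed
    finally show ?thesis
      using g by (simp add: y_def power_mult_distrib mult_left_mono)
  next
    \<comment> \<open>Here \<open>l - r = 0\<close>, so no digit is inspected, the strict inequality
      reads \<open>0 < 0\<close>, and \<open>Bad r l\<close> is empty.\<close>
    case False
    then show ?thesis
      using \<tau> by (simp add: Bad_def y_def)
  qed
  show ?thesis
  proof (rule meagerI[OF g, where y = y and K = "real k / \<tau> ^ (2 * k)"])
    have "2 * (3 / 4) \<le> real g * \<tau>"
      using g \<tau> by (intro mult_mono) auto
    then show "1 < y"
      by (simp add: y_def)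
    show "y < real g"
      using g \<tau> by (simp add: y_def)
    fix l
    have "{n \<in> scarce g w (1 / real g ^ length w - e). length (base_digits g n) = l} \<subseteq> (\<Union>r<k. Bad r l)"
    proof
      fix n assume n: "n \<in> {n \<in> scarce g w (1 / real g ^ length w - e). length (base_digits g n) = l}"
      then have "n < g ^ l"
        using less_power_length_base_digits[OF g, of n] by auto
      then show "n \<in> (\<Union>r<k. Bad r l)"
        using n by (auto simp: scarce_def Bad_def k_def b_def v_def p_def)
    qed
    then have "card {n \<in> scarce g w (1 / real g ^ length w - e). length (base_digits g n) = l} \<le> card (\<Union>r<k. Bad r l)"
      by (intro card_mono) (auto simp: Bad_def)
    also have "\<dots> \<le> (\<Sum>r<k. card (Bad r l))"
      by (rule card_UN_le) simp
    finally have "real (card {n \<in> scarce g w (1 / real g ^ length w - e). length (base_digits g n) = l}) \<le> (\<Sum>r<k. real (card (Bad r l)))"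
      by (metis of_nat_le_iff of_nat_sum)
    also have "\<dots> \<le> (\<Sum>r<k. y ^ l / \<tau> ^ (2 * k))"
      by (intro sum_mono bad) simp
    finally show "real (card {n \<in> scarce g w (1 / real g ^ length w - e). length (base_digits g n) = l}) \<le> real k / \<tau> ^ (2 * k) * y ^ l"
      by simp
  qed (use \<tau> in \<open>auto simp: scarce_def\<close>)
qed

text \<open>Each residue class has at least \<open>(l - 2 * k) / k\<close> complete blocks, a
  fraction \<open>p\<close> of which are copies of \<open>w\<close>. Summing over the
  \<open>k\<close> classes loses at most \<open>2 * k\<close>, as \<open>p \<le> 1\<close>.\<close>

lemma occurrences_not_scarce:
  assumes g: "g \<ge> 2" and w: "set w \<subseteq> {0..<g}" "w \<noteq> []" and p: "0 \<le> p" "p \<le> 1"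
    and n: "n \<ge> 1" "n \<notin> scarce g w p"
  shows "real (occurrences w (base_digits g n)) \<ge> p * real (length (base_digits g n)) - 2 * real (length w)"
proof -
  define k where "k = length w"
  define l where "l = length (base_digits g n)"
  have k: "k > 0"
    using w by (simp add: k_def)
  have "p * real l - 2 * real k \<le> p * (real l - 2 * real k)"
    using p mult_right_mono[of p 1 "2 * real k"] by (simp add: algebra_simps)
  also have "\<dots> = (\<Sum>r<k. p * ((real l - 2 * real k) / real k))"
    using k by simp
  also have "\<dots> \<le> (\<Sum>r<k. real (digit_count (g ^ k) (word_value g w) ((l - r) div k) (n div g ^ r)))"
  proof (rule sum_mono)
    fix r assume r: "r \<in> {..<k}"
    have "l < k * ((l - r) div k) + 2 * k"
      using r k dividend_less_div_times[of k "l - r"] by (simp add: algebra_simps)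
    then have "real l < real k * real ((l - r) div k) + 2 * real k"
      by (metis of_nat_add of_nat_less_iff of_nat_mult of_nat_numeral)
    then have "(real l - 2 * real k) / real k \<le> real ((l - r) div k)"
      using k by (simp add: field_simps)
    then have "p * ((real l - 2 * real k) / real k) \<le> p * real ((l - r) div k)"
      using p by (intro mult_left_mono)
    also have "\<dots> \<le> real (digit_count (g ^ k) (word_value g w) ((l - r) div k) (n div g ^ r))"
      using n r unfolding scarce_def k_def l_def by (force simp: not_less)
    finally show "p * ((real l - 2 * real k) / real k) \<le> \<dots>" .
  qed
  also have "\<dots> \<le> real (occurrences w (base_digits g n))"
    using occurrences_base_digits_ge[OF g w, of n] by (simp flip: of_nat_sum add: k_def l_def)
  finally show ?thesis
    by (simp add: k_def l_def)
qed

section \<open>Occurrences in concatenated blocks\<close>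

text \<open>Copies that straddle the boundary are dropped. An empty \<open>w\<close> would be
  counted twice there, at the end of \<open>xs\<close> and at the start of
  \<open>ys\<close>.\<close>

lemma occurrences_append:
  assumes "w \<noteq> []"
  shows "occurrences w xs + occurrences w ys \<le> occurrences w (xs @ ys)"
proof -
  let ?O = "\<lambda>xs. {i. i + length w \<le> length xs \<and> take (length w) (drop i xs) = w}"
  have "?O xs \<inter> (\<lambda>i. length xs + i) ` ?O ys = {}"
    using assms by auto
  moreover have "inj_on (\<lambda>i. length xs + i) (?O ys)"
    by simp
  ultimately have "card (?O xs) + card (?O ys) = card (?O xs \<union> (\<lambda>i. length xs + i) ` ?O ys)"
    by (subst card_Un_disjoint) (simp_all add: card_image finite_imageI finite_occurrences)
  also have "\<dots> \<le> card (?O (xs @ ys))"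
    by (intro card_mono finite_occurrences) auto
  finally show ?thesis
    by (simp add: occurrences_def)
qed

lemma occurrences_concat:
  assumes "w \<noteq> []"
  shows "(\<Sum>xs\<leftarrow>xss. occurrences w xs) \<le> occurrences w (concat xss)"
proof (induction xss)
  case (Cons xs xss)
  then show ?case
    using occurrences_append[OF assms, of xs "concat xss"] by simp
qed simp

text \<open>The count from \<open>normal_in_base\<close>, for an arbitrary sequence: only the start
  must lie below \<open>N\<close>, and the copy may extend beyond it.\<close>

definition hits :: "'a list \<Rightarrow> (nat \<Rightarrow> 'a) \<Rightarrow> nat \<Rightarrow> nat" where
  "hits w d N = card {i. i < N \<and> map d [i..<i + length w] = w}"

lemma occurrences_le_hits:
  assumes "length xs \<le> N" "\<And>i. i < length xs \<Longrightarrow> d i = xs ! i" "w \<noteq> []"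
  shows "occurrences w xs \<le> hits w d N"
  unfolding occurrences_def hits_def
proof (intro card_mono subsetI CollectI conjI)
  fix i assume i: "i \<in> {i. i + length w \<le> length xs \<and> take (length w) (drop i xs) = w}"
  then show "i < N"
    using assms by (cases w) auto
  have "i + length w \<le> length xs"
    using i by simp
  then have "map d [i..<i + length w] = take (length w) (drop i xs)"
    using assms(2) by (intro nth_equalityI) auto
  then show "map d [i..<i + length w] = w"
    using i by simp
qed simp

lemma flat_smap_fromN:
  assumes "\<And>n. n \<ge> a \<Longrightarrow> F n \<noteq> []"
  shows "flat (smap F (fromN a)) = concat (map F [a..<a + M]) @- flat (smap F (fromN (a + M)))"
proof (induction M)
  case (Suc M)
  have "fromN (a + M) = (a + M) ## fromN (Suc (a + M))"
    by (subst siterate.ctr) simp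
  then show ?case
    using Suc assms by simp
qed simp

section \<open>Averaging over the blocks\<close>

text \<open>Here \<open>a m\<close> is the length of block \<open>m\<close> and \<open>b m\<close>
  its number of occurrences. Blocks in \<open>S\<close> and the last block have \<open>o(X)\<close>
  members of length \<open>O(log X)\<close>, and the deficits \<open>D\<close> add up to
  \<open>O(X)\<close>; both are small against the total length. The right sum has one more block
  than the left one, to cover an incomplete last block.\<close>

lemma eventually_weighted_frequency:
  fixes a b :: "nat \<Rightarrow> nat" and p c C D e :: real
  assumes c: "c > 0" and e: "e > 0" and p: "0 \<le> p" "p \<le> 1" and "C \<ge> 0" "D \<ge> 0"
    and lower: "\<forall>\<^sub>F X in sequentially. c * real X * log1 (real X) \<le> real (\<Sum>m = 1..X. a m)"
    and upper: "\<And>m. m \<ge> 1 \<Longrightarrow> real (a m) \<le> C * log1 (real m)"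
    and S: "has_asymptotic_density S 0"
    and b: "\<And>m. m \<ge> 1 \<Longrightarrow> m \<notin> S \<Longrightarrow> real (b m) \<ge> p * real (a m) - D"
  shows "\<forall>\<^sub>F M in sequentially. real (\<Sum>m = 1..M. b m) \<ge> (p - e) * real (\<Sum>m = 1..Suc M. a m)"
proof -
  have log1: "log1 x \<ge> 1" for x
    by (simp add: log1_def)
  have "(\<lambda>X::nat. real (counting S (real X)) / real X) \<longlonglongrightarrow> 0"
    using S filterlim_compose[OF _ filterlim_real_sequentially] unfolding has_asymptotic_density_def by blast
  moreover have "(\<lambda>X::nat. 1 / real X) \<longlonglongrightarrow> 0"
    by (rule lim_1_over_n)
  moreover have "filterlim (\<lambda>X::nat. log1 (real X)) at_top sequentially"
  proof (rule filterlim_at_top_mono)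
    show "filterlim (\<lambda>X::nat. ln (real X)) at_top sequentially"
      by (rule filterlim_compose[OF ln_at_top filterlim_real_sequentially])
  qed (simp add: log1_def)
  then have "(\<lambda>X::nat. D / log1 (real X)) \<longlonglongrightarrow> 0"
    by (intro tendsto_divide_0[OF tendsto_const] filterlim_at_top_imp_at_infinity)
  ultimately have "(\<lambda>X::nat. C * (real (counting S (real X)) / real X + 1 / real X) + D / log1 (real X)) \<longlonglongrightarrow> C * (0 + 0) + 0"
    by (intro tendsto_intros)
  then have "\<forall>\<^sub>F X in sequentially. C * (real (counting S (real X)) / real X + 1 / real X) + D / log1 (real X) < e * c"
    using order_tendstoD(2)[of _ "C * (0 + 0) + 0" sequentially "e * c"] mult_pos_pos[OF e c] by simp
  then have "\<forall>\<^sub>F X in sequentially. real (\<Sum>m\<in>{1..<X}. b m) \<ge> (p - e) * real (\<Sum>m = 1..X. a m)"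
    using lower eventually_ge_at_top[of 1]
  proof eventually_elim
    case (elim X)
    \<comment> \<open>The indices for which only the trivial bound on the length is used.\<close>
    define U where "U = {m \<in> {1..X}. m \<in> S \<or> m = X}"
    have "card U \<le> counting S (real X) + 1"
    proof -
      have "U \<subseteq> insert X {n \<in> S. 1 \<le> n \<and> real n \<le> real X}"
        by (auto simp: U_def)
      moreover have fin: "finite {n \<in> S. 1 \<le> n \<and> real n \<le> real X}"
        by (rule finite_subset[of _ "{..X}"]) auto
      ultimately have "card U \<le> card (insert X {n \<in> S. 1 \<le> n \<and> real n \<le> real X})"
        by (intro card_mono) auto
      also have "\<dots> \<le> counting S (real X) + 1"
        using fin by (simp add: counting_def card_insert_if)
      finally show ?thesis .
    qed
    then have U: "real (card U) \<le> real (counting S (real X)) + 1"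
      by linarith
    have "p * real (\<Sum>m = 1..X. a m) = (\<Sum>m = 1..X. p * real (a m))"
      by (simp add: sum_distrib_left)
    also have "\<dots> \<le> (\<Sum>m = 1..X. (if m < X then real (b m) else 0) + D + (if m \<in> U then C * log1 (real X) else 0))"
    proof (rule sum_mono)
      fix m assume m: "m \<in> {1..X}"
      show "p * real (a m) \<le> (if m < X then real (b m) else 0) + D + (if m \<in> U then C * log1 (real X) else 0)"
      proof (cases "m \<in> U")
        case True
        have "log1 (real m) \<le> log1 (real X)"
          using m unfolding log1_def by (intro max.mono ln_mono) auto
        then have "C * log1 (real m) \<le> C * log1 (real X)"
          using \<open>C \<ge> 0\<close> by (rule mult_left_mono)
        moreover have "p * real (a m) \<le> 1 * real (a m)"
          using p by (intro mult_right_mono) auto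
        ultimately have "p * real (a m) \<le> C * log1 (real X)"
          using upper[of m] m by simp
        then show ?thesis
          using True \<open>D \<ge> 0\<close> by simp
      next
        case False
        then show ?thesis
          using b[of m] m by (auto simp: U_def)
      qed
    qed
    also have "\<dots> = real (\<Sum>m\<in>{1..<X}. b m) + real X * D + real (card U) * (C * log1 (real X))"
    proof -
      have "(\<Sum>m = 1..X. if m < X then real (b m) else 0) = (\<Sum>m\<in>{1..<X}. real (b m))"
        by (intro sum.mono_neutral_cong_right) auto
      moreover have "(\<Sum>m = 1..X. if m \<in> U then C * log1 (real X) else 0) = (\<Sum>m\<in>U. C * log1 (real X))"
        by (intro sum.mono_neutral_cong_right) (auto simp: U_def)
      ultimately show ?thesis
        by (simp add: sum.distrib)
    qed
    also have "real (card U) * (C * log1 (real X)) \<le> (real (counting S (real X)) + 1) * (C * log1 (real X))"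
      using U \<open>C \<ge> 0\<close> log1[of "real X"] by (intro mult_right_mono) auto
    \<comment> \<open>Factoring out \<open>X * log1 X\<close> exposes the relative error, which was
      shown above to be eventually below \<open>e * c\<close>.\<close>
    also have "real (\<Sum>m\<in>{1..<X}. b m) + real X * D + (real (counting S (real X)) + 1) * (C * log1 (real X)) =
        real (\<Sum>m\<in>{1..<X}. b m) +
          real X * log1 (real X) * (C * (real (counting S (real X)) / real X + 1 / real X) + D / log1 (real X))"
      using elim(3) log1[of "real X"] by (simp add: field_simps)
    also have "real X * log1 (real X) * (C * (real (counting S (real X)) / real X + 1 / real X) + D / log1 (real X))
        \<le> real X * log1 (real X) * (e * c)"
      using elim(1) log1[of "real X"] by (intro mult_left_mono) auto
    also have "\<dots> = e * (c * real X * log1 (real X))"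
      by simp
    also have "\<dots> \<le> e * real (\<Sum>m = 1..X. a m)"
      using elim(2) e by (intro mult_left_mono) auto
    finally show ?case
      by (simp add: algebra_simps)
  qed
  then have "\<forall>\<^sub>F M in sequentially. real (\<Sum>m\<in>{1..<Suc M}. b m) \<ge> (p - e) * real (\<Sum>m = 1..Suc M. a m)"
    by (subst eventually_sequentially_Suc)
  then show ?thesis
    by (simp only: atLeastLessThanSuc_atLeastAtMost)
qed

section \<open>Number of digits and logarithm\<close>

text \<open>The maximum with 1 matters for \<open>g = 2\<close>: \<open>log1\<close> is never below
  1, whereas \<open>ln 2 < 1\<close>.\<close>

lemma log1_le_length_base_digits:
  assumes "g \<ge> 2" "n \<ge> 1"
  shows "log1 (real n) \<le> max 1 (ln (real g)) * real (length (base_digits g n))"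
proof -
  let ?l = "length (base_digits g n)"
  have l: "?l \<ge> 1"
    using assms by (simp add: base_digits_pos)
  have "real n \<le> real g ^ ?l"
    using less_power_length_base_digits[OF assms(1), of n] by (metis less_imp_le of_nat_le_iff of_nat_power)
  then have "ln (real n) \<le> ln (real g ^ ?l)"
    using assms by (subst ln_le_cancel_iff) auto
  also have "\<dots> = ln (real g) * real ?l"
    using assms by (simp add: ln_realpow)
  also have "\<dots> \<le> max 1 (ln (real g)) * real ?l"
    by (intro mult_right_mono) auto
  finally have "ln (real n) \<le> max 1 (ln (real g)) * real ?l" .
  moreover have "1 * 1 \<le> max 1 (ln (real g)) * real ?l"
    using l by (intro mult_mono) auto
  ultimately show ?thesis
    by (simp add: log1_def)
qed

lemma length_base_digits_le_log1:
  assumes "g \<ge> 2" "n \<ge> 1"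
  shows "real (length (base_digits g n)) \<le> (1 + 1 / ln (real g)) * log1 (real n)"
proof -
  let ?l = "length (base_digits g n)"
  have g: "ln (real g) > 0"
    using assms by simp
  have "real g ^ ?l \<le> real g * real n"
    using power_length_base_digits_le[OF assms(1), of n] assms by (metis of_nat_le_iff of_nat_power of_nat_mult less_eq_Suc_le One_nat_def)
  then have "ln (real g ^ ?l) \<le> ln (real g * real n)"
    using assms by (subst ln_le_cancel_iff) auto
  then have "real ?l * ln (real g) \<le> ln (real g) + ln (real n)"
    using assms by (simp add: ln_realpow ln_mult)
  then have "real ?l \<le> 1 + ln (real n) / ln (real g)"
    using g by (simp add: field_simps)
  also have "\<dots> \<le> log1 (real n) + log1 (real n) / ln (real g)"
    using g by (intro add_mono divide_right_mono) (auto simp: log1_def)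
  finally show ?thesis
    by (simp add: algebra_simps)
qed

section \<open>From a digit sequence to the real number\<close>

text \<open>Multiplied by \<open>g ^ (n + 1)\<close>, the sum is the integer spelled by the first
  \<open>n + 1\<close> digits plus a tail \<open>t\<close>. A later digit other than
  \<open>g - 1\<close> forces \<open>t < 1\<close>, so the floor is that integer, whose residue
  modulo \<open>g\<close> is its last digit.\<close>

lemma expansion_digit_suminf:
  assumes g: "g \<ge> 2" and d: "\<And>i. d i < g" and inf: "\<exists>\<^sub>\<infinity>i. d i \<noteq> g - 1"
  shows "expansion_digit g (\<Sum>i. real (d i) / real g ^ (i + 1)) n = d n"
proof -
  define h where "h i = real (d i) / real g ^ (i + 1)" for i
  have geo: "(\<lambda>i. (real g - 1) / real g ^ (i + 1)) sums 1"
  proof -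
    have "(\<lambda>i. (real g - 1) / real g * (1 / real g) ^ i) sums ((real g - 1) / real g * (1 / (1 - 1 / real g)))"
      using g by (intro sums_mult geometric_sums) auto
    then show ?thesis
      using g by (simp add: field_simps)
  qed
  have d': "real (d i) \<le> real g - 1" for i
    using d[of i] by linarith
  have summable: "summable (\<lambda>i. real (d (i + m)) / real g ^ (i + 1))" for m
    using d' g by (intro summable_comparison_test'[OF sums_summable[OF geo]])
      (simp add: divide_right_mono)
  define t where "t = (\<Sum>i. real (d (i + Suc n)) / real g ^ (i + 1))"
  have "t \<ge> 0"
    unfolding t_def by (intro suminf_nonneg summable) simp
  have "t < 1"
  proof -
    obtain j where j: "j > n" "d j \<noteq> g - 1"
      using inf by (meson INFM_nat)
    have "0 < (\<Sum>i. (real g - 1) / real g ^ (i + 1) - real (d (i + Suc n)) / real g ^ (i + 1))"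
    proof (rule suminf_pos2[where i = "j - Suc n"])
      show "summable (\<lambda>i. (real g - 1) / real g ^ (i + 1) - real (d (i + Suc n)) / real g ^ (i + 1))"
        by (intro summable_diff summable sums_summable[OF geo])
      have "real (d j) < real g - 1"
        using j d[of j] by linarith
      then show "0 < (real g - 1) / real g ^ (j - Suc n + 1) - real (d (j - Suc n + Suc n)) / real g ^ (j - Suc n + 1)"
        using j g by (simp add: divide_strict_right_mono)
    qed (use d' in \<open>simp add: divide_right_mono\<close>)
    also have "\<dots> = 1 - t"
      unfolding t_def using suminf_diff[OF sums_summable[OF geo] summable[of "Suc n"]] sums_unique[OF geo] by simp
    finally show ?thesis
      by simp
  qed
  have prefix: "(\<Sum>i<m. h i) * real g ^ m = real (word_value g (map d [0..<m]))" for m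
  proof (induction m)
    case 0
    then show ?case
      by (simp add: word_value_def)
  next
    case (Suc m)
    have "(\<Sum>i<Suc m. h i) * real g ^ Suc m = (\<Sum>i<m. h i) * real g ^ m * real g + h m * real g ^ Suc m"
      by (simp add: algebra_simps)
    also have "h m * real g ^ Suc m = real (d m)"
      using g by (simp add: h_def)
    finally show ?case
      by (simp add: Suc)
  qed
  have "(\<Sum>i. h i) = (\<Sum>i. h (i + Suc n)) + (\<Sum>i<Suc n. h i)"
    using summable[of 0] by (intro suminf_split_initial_segment) (simp add: h_def)
  also have "(\<Sum>i. h (i + Suc n)) = t / real g ^ (n + 1)"
  proof -
    have "h (i + Suc n) = real (d (i + Suc n)) / real g ^ (i + 1) / real g ^ (n + 1)" for i
      by (simp add: h_def power_add field_simps)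
    then show ?thesis
      unfolding t_def by (simp only: suminf_divide[OF summable])
  qed
  finally have "(\<Sum>i. h i) * real g ^ (n + 1) = t + (\<Sum>i<Suc n. h i) * real g ^ Suc n"
    using g by (simp add: field_simps)
  then have eq: "(\<Sum>i. h i) * real g ^ (n + 1) = t + real (word_value g (map d [0..<Suc n]))"
    by (simp only: prefix)
  have "(\<Sum>i. h i) \<ge> 0"
    using summable[of 0] by (intro suminf_nonneg) (simp_all add: h_def)
  then have "\<lfloor>\<bar>\<Sum>i. h i\<bar> * real g ^ (n + 1)\<rfloor> = int (word_value g (map d [0..<Suc n]))"
    using \<open>t \<ge> 0\<close> \<open>t < 1\<close> unfolding abs_of_nonneg[OF \<open>(\<Sum>i. h i) \<ge> 0\<close>] eq
    by (intro floor_unique) (simp_all del: upt_Suc)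
  also have "\<dots> mod int g = int (d n)"
    using d[of n] by (simp flip: of_nat_mod)
  finally show ?thesis
    by (simp add: expansion_digit_def h_def)
qed

section \<open>Lower bounds on all frequencies suffice\<close>

text \<open>Exactly one word of length \<open>k\<close> starts at each position.\<close>

lemma sum_hits:
  assumes "\<And>i. d i \<in> A" "finite A"
  shows "(\<Sum>w | set w \<subseteq> A \<and> length w = k. hits w d N) = N"
proof -
  let ?W = "{w. set w \<subseteq> A \<and> length w = k}"
  have "(\<Sum>w\<in>?W. hits w d N) = (\<Sum>w\<in>?W. card {i \<in> {..<N}. map d [i..<i + k] = w})"
    by (intro sum.cong refl) (auto simp: hits_def)
  also have "\<dots> = card (\<Union>w\<in>?W. {i \<in> {..<N}. map d [i..<i + k] = w})"
    using assms by (subst card_UN_disjoint) (auto simp: finite_lists_length_eq)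
  also have "(\<Union>w\<in>?W. {i \<in> {..<N}. map d [i..<i + k] = w}) = {..<N}"
    using assms by auto
  finally show ?thesis
    by simp
qed

text \<open>With \<open>b\<close> words in all, the other \<open>b - 1\<close> take up at least
  \<open>(b - 1) * (1 / b - e')\<close> of the positions, leaving at most
  \<open>1 / b + (b - 1) * e'\<close> for \<open>w\<close>.\<close>

lemma hits_tendsto:
  fixes A :: "'a set"
  assumes A: "finite A" "A \<noteq> {}" and d: "\<And>i. d i \<in> A"
    and lower: "\<And>w e. set w \<subseteq> A \<Longrightarrow> length w = k \<Longrightarrow> e > 0 \<Longrightarrow>
      \<forall>\<^sub>F N in sequentially. real (hits w d N) \<ge> (1 / real (card A) ^ k - e) * real N"
    and w: "set w \<subseteq> A" "length w = k"
  shows "(\<lambda>N. real (hits w d N) / real N) \<longlonglongrightarrow> 1 / real (card A) ^ k"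
proof (rule tendstoI)
  fix e :: real assume e: "e > 0"
  define W where "W = {w. set w \<subseteq> A \<and> length w = k}"
  define b where "b = real (card A) ^ k"
  have W: "finite W" "real (card W) = b" "w \<in> W"
    using A w by (auto simp: W_def b_def finite_lists_length_eq card_lists_length_eq)
  have b: "b > 0"
    using A by (simp add: b_def card_gt_0_iff)
  \<comment> \<open>Chosen so that both the deficit \<open>e'\<close> and the excess
    \<open>(b - 1) * e'\<close> stay below \<open>e\<close>.\<close>
  define e' where "e' = e / (2 * b + 2)"
  have e': "e' > 0" "e' < e" "b * e' < e"
    using e b by (simp_all add: e'_def field_simps add_pos_pos)
  have "\<forall>\<^sub>F N in sequentially. \<forall>u\<in>W. real (hits u d N) \<ge> (1 / b - e') * real N"
    using W lower e' by (intro eventually_ball_finite) (auto simp: W_def b_def)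
  then show "\<forall>\<^sub>F N in sequentially. dist (real (hits w d N) / real N) (1 / real (card A) ^ k) < e"
    using eventually_gt_at_top[of 0]
  proof eventually_elim
    case (elim N)
    have "real N = (\<Sum>u\<in>W. real (hits u d N))"
      using sum_hits[OF d A(1), where k = k and N = N] by (simp flip: of_nat_sum add: W_def)
    also have "\<dots> = real (hits w d N) + (\<Sum>u\<in>W - {w}. real (hits u d N))"
      using W by (simp add: sum.remove)
    also have "\<dots> \<ge> real (hits w d N) + (\<Sum>u\<in>W - {w}. (1 / b - e') * real N)"
      using elim by (intro add_left_mono sum_mono) auto
    also have "(\<Sum>u\<in>W - {w}. (1 / b - e') * real N) = (b - 1) * ((1 / b - e') * real N)"
    proof -
      have "card W \<ge> 1"
        using W by (metis card_0_eq empty_iff less_one not_less)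
      then show ?thesis
        using W by (simp add: of_nat_diff)
    qed
    finally have "real (hits w d N) / real N \<le> 1 - (b - 1) * (1 / b - e')"
      using elim by (simp add: field_simps)
    also have "\<dots> = 1 / b + (b - 1) * e'"
      using b by (simp add: field_simps)
    also have "\<dots> < 1 / b + e"
      using e' by (simp add: algebra_simps)
    finally have "real (hits w d N) / real N < 1 / b + e" .
    moreover have "1 / b - e' \<le> real (hits w d N) / real N"
      using elim W by (simp add: field_simps)
    ultimately show ?case
      using e' by (simp add: dist_real_def b_def abs_less_iff)
  qed
qed

section \<open>Normality of the concatenated number\<close>

theorem theorem1p1:
  fixes g :: nat and f :: "nat \<Rightarrow> nat"
  assumes "g \<ge> 2"
    and "\<forall>n\<ge>1. f n \<ge> 1"
    and "weakly_polynomial_growth f"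
    and "\<forall>E. meager E \<longrightarrow> has_asymptotic_density {n. n \<ge> 1 \<and> f n \<in> E} 0"
  shows "normal_in_base g (concat_real g f)"
proof -
  define d where "d = snth (concat_digits g f)"
  define F where "F m = base_digits g (f m)" for m
  define L where "L M = (\<Sum>m = 1..M. length (F m))" for M
  have F: "F m \<noteq> []" if "m \<ge> 1" for m
    using assms(1,2) that by (simp add: F_def base_digits_eq_Nil_iff Suc_le_eq)
  have stream: "concat_digits g f = concat (map F [1..<1 + M]) @- flat (smap F (fromN (1 + M)))" for M
    using flat_smap_fromN[of 1 F M] F unfolding concat_digits_def F_def by simp
  have len: "length (concat (map F [1..<1 + M])) = L M" for M
    by (simp add: length_concat comp_def L_def sum_list_distinct_conv_sum_set atLeastLessThanSuc_atLeastAtMost del: upt_Suc)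
  have d_nth: "d i = concat (map F [1..<1 + M]) ! i" if "i < L M" for i M
    using that len[of M] unfolding d_def stream[of M] by (simp add: shift_snth_less del: upt_Suc)
  have L_ge: "M \<le> L M" for M
  proof -
    have "(\<Sum>m = 1..M. 1) \<le> L M"
      unfolding L_def using F by (intro sum_mono) (auto simp: Suc_le_eq)
    then show ?thesis
      by simp
  qed
  have L_mono: "mono L"
    unfolding L_def by (intro monoI sum_mono2) auto
  have d_less: "d i \<in> {0..<g}" for i
  proof -
    have i: "i < L (Suc i)"
      using L_ge[of "Suc i"] by simp
    then have "d i \<in> set (concat (map F [1..<1 + Suc i]))"
      unfolding d_nth[OF i] by (intro nth_mem) (simp only: len)
    then show ?thesis
      using set_base_digits[OF assms(1)] unfolding F_def by fastforce
  qed
  obtain c C x1 :: real where c: "c > 0" "C > 0"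
    and lower: "\<And>x. x > x1 \<Longrightarrow> (\<Sum>m | 1 \<le> m \<and> real m \<le> x. log1 (real (f m))) \<ge> c * x * log1 x"
    and upper: "\<And>m. m \<ge> 1 \<Longrightarrow> log1 (real (f m)) \<le> C * log1 (real m)"
    using assms(3) unfolding weakly_polynomial_growth_def by blast
  define G where "G = max 1 (ln (real g))"
  have G: "G > 0"
    by (simp add: G_def)
  \<comment> \<open>The growth condition is transferred from logarithms of values to lengths of
    blocks.\<close>
  have L_lower: "\<forall>\<^sub>F X in sequentially. c / G * real X * log1 (real X) \<le> real (\<Sum>m = 1..X. length (F m))"
    using eventually_gt_at_top[of "nat \<lceil>x1\<rceil>"]
  proof eventually_elim
    case (elim X)
    have "{m. 1 \<le> m \<and> real m \<le> real X} = {1..X}"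
      by auto
    then have "c * real X * log1 (real X) \<le> (\<Sum>m = 1..X. log1 (real (f m)))"
      using lower[of "real X"] elim by (simp add: nat_less_iff) linarith
    also have "\<dots> \<le> (\<Sum>m = 1..X. G * real (length (F m)))"
      unfolding G_def F_def using assms(1,2) by (intro sum_mono log1_le_length_base_digits) auto
    finally show ?case
      using G by (simp add: sum_distrib_left[symmetric] field_simps)
  qed
  define C' where "C' = (1 + 1 / ln (real g)) * C"
  have lng: "1 + 1 / ln (real g) \<ge> 0"
    using assms(1) by simp
  then have C': "C' \<ge> 0"
    using c by (simp add: C'_def)
  have L_upper: "real (length (F m)) \<le> C' * log1 (real m)" if "m \<ge> 1" for m
  proof -
    have "real (length (F m)) \<le> (1 + 1 / ln (real g)) * log1 (real (f m))"
      unfolding F_def using assms(1,2) that by (intro length_base_digits_le_log1) auto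
    also have "\<dots> \<le> (1 + 1 / ln (real g)) * (C * log1 (real m))"
      using lng upper[OF that] by (intro mult_left_mono)
    finally show ?thesis
      by (simp add: C'_def)
  qed
  have lower_frequency: "\<forall>\<^sub>F N in sequentially. real (hits w d N) \<ge> (1 / real g ^ length w - e) * real N"
    if w: "set w \<subseteq> {0..<g}" "w \<noteq> []" and e: "e > 0" for w e
  \<comment> \<open>For a negative target the bound is trivial; otherwise \<open>N\<close> may be
    replaced by a larger number on the right.\<close>
  proof (cases "1 / real g ^ length w - e \<ge> 0")
    case True
    \<comment> \<open>Half of \<open>e\<close> goes into the threshold for scarcity, the other half
      into the averaging over blocks.\<close>
    define p where "p = 1 / real g ^ length w - e / 2"
    have "1 / real g ^ length w \<le> 1"
      using assms(1) by simp
    then have p: "0 \<le> p" "p \<le> 1"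
      using True e unfolding p_def by linarith+
    define S where "S = {n. n \<ge> 1 \<and> f n \<in> scarce g w p}"
    have S: "has_asymptotic_density S 0"
      using assms(4) meager_scarce[OF assms(1) w, of "e / 2"] e by (simp add: S_def p_def)
    have "\<forall>\<^sub>F M in sequentially. real (\<Sum>m = 1..M. occurrences w (F m)) \<ge> (p - e / 2) * real (\<Sum>m = 1..Suc M. length (F m))"
    proof (rule eventually_weighted_frequency[OF _ _ p C' _ L_lower L_upper S])
      fix m assume "m \<ge> 1" "m \<notin> S"
      then show "p * real (length (F m)) - 2 * real (length w) \<le> real (occurrences w (F m))"
        unfolding F_def using assms(2) by (intro occurrences_not_scarce[OF assms(1) w p]) (auto simp: S_def)
    qed (use c G e in auto)
    then obtain M0 where M0: "\<And>M. M \<ge> M0 \<Longrightarrow> real (\<Sum>m = 1..M. occurrences w (F m)) \<ge> (p - e / 2) * real (L (Suc M))"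
      by (auto simp: eventually_sequentially L_def)
    have pe: "p - e / 2 = 1 / real g ^ length w - e"
      by (simp add: p_def)
    show ?thesis
      using eventually_ge_at_top[of "L M0"]
    proof eventually_elim
      case (elim N)
      \<comment> \<open>Writing \<open>n = Suc M\<close>, one gets
        \<open>L M \<le> N < L (Suc M)\<close>: the first \<open>M\<close> blocks lie entirely below
        \<open>N\<close>, and block \<open>Suc M\<close> is cut.\<close>
      define n where "n = (LEAST n. N < L n)"
      have ex: "N < L (Suc N)"
        using L_ge[of "Suc N"] by simp
      have n: "N < L n"
        unfolding n_def by (rule LeastI[of "\<lambda>n. N < L n", OF ex])
      have "n > M0"
        using n elim monoD[OF L_mono, of n M0] by (meson leD leI le_trans)
      then obtain M where M: "n = Suc M" "M \<ge> M0"
        by (cases n) auto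
      have LM: "L M \<le> N"
        using not_less_Least[of M "\<lambda>n. N < L n"] M by (simp add: n_def)
      have "(1 / real g ^ length w - e) * real N \<le> (p - e / 2) * real (L (Suc M))"
        unfolding pe using True n M by (intro mult_left_mono) auto
      also have "\<dots> \<le> real (\<Sum>m = 1..M. occurrences w (F m))"
        using M0 M by simp
      also have "\<dots> \<le> real (hits w d N)"
      proof -
        have "(\<Sum>m = 1..M. occurrences w (F m)) = (\<Sum>xs\<leftarrow>map F [1..<1 + M]. occurrences w xs)"
          by (simp add: comp_def sum_list_distinct_conv_sum_set atLeastLessThanSuc_atLeastAtMost del: upt_Suc)
        also have "\<dots> \<le> occurrences w (concat (map F [1..<1 + M]))"
          by (rule occurrences_concat[OF w(2)])
        also have "\<dots> \<le> hits w d N"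
          using LM d_nth w by (intro occurrences_le_hits) (simp_all only: len, simp_all)
        finally show ?thesis
          by (simp only: of_nat_le_iff)
      qed
      finally show ?case .
    qed
  next
    case False
    then have "(1 / real g ^ length w - e) * real N \<le> real (hits w d N)" for N
      by (intro order_trans[OF mult_nonpos_nonneg]) auto
    then show ?thesis
      by simp
  qed
  have frequency: "(\<lambda>N. real (hits w d N) / real N) \<longlonglongrightarrow> 1 / real g ^ length w"
    if w: "set w \<subseteq> {0..<g}" "w \<noteq> []" for w
  proof -
    have "(\<lambda>N. real (hits w d N) / real N) \<longlonglongrightarrow> 1 / real (card {0..<g}) ^ length w"
    proof (rule hits_tendsto[OF _ _ d_less _ w(1) refl])
      fix u and e :: real assume u: "set u \<subseteq> {0..<g}" "length u = length w" "e > 0"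
      then have "u \<noteq> []"
        using w by auto
      then show "\<forall>\<^sub>F N in sequentially. real (hits u d N) \<ge> (1 / real (card {0..<g}) ^ length w - e) * real N"
        using lower_frequency[of u e] u by simp
    qed (use assms(1) in auto)
    then show ?thesis
      by simp
  qed
  \<comment> \<open>This rules out a tail of digits \<open>g - 1\<close>, for which
    \<open>expansion_digit\<close> would return the other expansion. With finitely many zeros, the
    word \<open>[0]\<close> would have frequency 0 instead of \<open>1 / g\<close>.\<close>
  have "\<exists>\<^sub>\<infinity>i. d i = 0"
  proof (rule ccontr)
    assume "\<not> (\<exists>\<^sub>\<infinity>i. d i = 0)"
    then have fin: "finite {i. d i = 0}"
      by (simp add: frequently_cofinite)
    have "(\<lambda>N. real (hits [0] d N) / real N) \<longlonglongrightarrow> 0"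
    proof (rule tendsto_sandwich[OF _ _ tendsto_const])
      have "hits [0] d N \<le> card {i. d i = 0}" for N
        unfolding hits_def by (intro card_mono fin) auto
      then show "\<forall>\<^sub>F N in sequentially. real (hits [0] d N) / real N \<le> real (card {i. d i = 0}) / real N"
        by (simp add: divide_right_mono)
      show "(\<lambda>N. real (card {i. d i = 0}) / real N) \<longlonglongrightarrow> 0"
        by (rule lim_const_over_n)
    qed simp
    moreover have "(\<lambda>N. real (hits [0] d N) / real N) \<longlonglongrightarrow> 1 / real g"
      using frequency[of "[0]"] assms(1) by simp
    ultimately show False
      using LIMSEQ_unique assms(1) by fastforce
  qed
  then have "\<exists>\<^sub>\<infinity>i. d i \<noteq> g - 1"
    by (rule frequently_elim1) (use assms(1) in auto)
  then have "expansion_digit g (concat_real g f) = d"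
    using expansion_digit_suminf[OF assms(1), of d] d_less by (simp add: concat_real_def d_def fun_eq_iff)
  then show ?thesis
    unfolding normal_in_base_def
  proof (intro allI impI)
    fix k :: nat and w :: "nat list"
    assume "k \<ge> 1" and w: "length w = k \<and> set w \<subseteq> {0..<g}"
    then have "w \<noteq> []"
      by auto
    then show "(\<lambda>N. real (card {i. i < N \<and> map (expansion_digit g (concat_real g f)) [i..<i + k] = w}) / real N)
        \<longlonglongrightarrow> 1 / real g ^ k"
      using frequency[of w] w \<open>expansion_digit g (concat_real g f) = d\<close> by (simp add: hits_def)
  qed
qed

end
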